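(* Let $n$ and $m$ be integers such that $m$ is even and $6\leq m\leq 2n-2$. Then $$R(K_{1,n},W_m)\geq\begin{cases}2n+m/2-1, & \text{if both } n \text{ and } m/2 \text{ are even};\\ 2n+m/2, & \text{otherwise.}\end{cases}$$
   Context: All graphs are finite and simple. For graphs $G_1,G_2$, the Ramsey number $R(G_1,G_2)$ is the least integer $r$ such that for every graph $G$ on $r$ vertices, either $G$ contains a subgraph isomorphic to $G_1$ or the complement $\overline{G}$ contains a subgraph isomorphic to $G_2$. $K_{1,n}$ is the star with $n$ leaves. For $m\geq 3$, the wheel $W_m$ is the graph on $m+1$ vertices obtained from a cycle $C_m$ by adding one new vertex adjacent to all vertices of the cycle. *)

theory Defs
  imports
    "Graph_Theory.Digraph_Isomorphism"
    "Graph_Theory.Kuratowski"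
    "HOL-Library.Ramsey"
begin

text \<open>
  A finite simple graph is a \<^emph>\<open>pair_graph\<close>: a finite vertex set with a symmetric and
  irreflexive set of arcs, an edge \<open>uv\<close> being the two arcs \<open>(u, v)\<close> and \<open>(v, u)\<close>.
\<close>

definition complement_graph :: "'a pair_pre_digraph \<Rightarrow> 'a pair_pre_digraph" where
  "complement_graph G =
    \<lparr> pverts = pverts G,
      parcs = {(u, v). u \<in> pverts G \<and> v \<in> pverts G \<and> u \<noteq> v \<and> (u, v) \<notin> parcs G} \<rparr>"

definition contains_copy :: "'a pair_pre_digraph \<Rightarrow> 'b pair_pre_digraph \<Rightarrow> bool" where
  "contains_copy G F \<longleftrightarrow>
    (\<exists>H. pair_graph H \<and> subgraph (with_proj H) (with_proj G) \<and>
         digraph_iso (with_proj F) (with_proj H))"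

text \<open>
  Host graphs live on sets of natural numbers; up to isomorphism these are all finite graphs.
\<close>

definition ramsey_property :: "'a pair_pre_digraph \<Rightarrow> 'b pair_pre_digraph \<Rightarrow> nat \<Rightarrow> bool" where
  "ramsey_property G1 G2 r \<longleftrightarrow>
    (\<forall>G :: nat pair_pre_digraph. pair_graph G \<and> card (pverts G) = r \<longrightarrow>
       contains_copy G G1 \<or> contains_copy (complement_graph G) G2)"

text \<open>The \<open>LEAST\<close> is attained, see \<open>ramsey_number_attained\<close> below.\<close>

definition ramsey_number :: "'a pair_pre_digraph \<Rightarrow> 'b pair_pre_digraph \<Rightarrow> nat" where
  "ramsey_number G1 G2 = (LEAST r. ramsey_property G1 G2 r)"

definition star_graph :: "nat \<Rightarrow> nat pair_pre_digraph" where
  "star_graph n = \<lparr> pverts = {0..n}, parcs = {0} \<times> {1..n} \<union> {1..n} \<times> {0} \<rparr>"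

text \<open>Only meaningful for \<open>m \<ge> 3\<close>.\<close>

definition cycle_graph :: "nat \<Rightarrow> nat pair_pre_digraph" where
  "cycle_graph m =
    \<lparr> pverts = {..<m},
      parcs = (\<Union>i<m. {(i, Suc i mod m), (Suc i mod m, i)}) \<rparr>"

definition wheel_graph :: "nat \<Rightarrow> nat pair_pre_digraph" where
  "wheel_graph m =
    \<lparr> pverts = insert m (pverts (cycle_graph m)),
      parcs = parcs (cycle_graph m) \<union> {m} \<times> pverts (cycle_graph m) \<union> pverts (cycle_graph m) \<times> {m} \<rparr>"

lemma pair_graph_iff:
  "pair_graph G \<longleftrightarrow> finite (pverts G) \<and> parcs G \<subseteq> pverts G \<times> pverts G \<and> sym (parcs G) \<and> irrefl (parcs G)"
proof
  assume "pair_graph G"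
  then interpret pair_graph G .
  have "sym (parcs G)"
    using pair_sym_arcs by (simp add: symmetric_def)
  then show "finite (pverts G) \<and> parcs G \<subseteq> pverts G \<times> pverts G \<and> sym (parcs G) \<and> irrefl (parcs G)"
    using pair_finite_verts pair_no_loops[of "(a, a)" for a] in_arcsD1 in_arcsD2
    unfolding irrefl_def by auto
next
  assume *: "finite (pverts G) \<and> parcs G \<subseteq> pverts G \<times> pverts G \<and> sym (parcs G) \<and> irrefl (parcs G)"
  then have "finite (parcs G)"
    by (meson finite_SigmaI finite_subset)
  with * show "pair_graph G"
    by unfold_locales (auto simp: symmetric_def irrefl_def)
qed

lemma pair_graph_complement_graph:
  "pair_graph G \<Longrightarrow> pair_graph (complement_graph G)"
  unfolding pair_graph_iff by (auto simp: complement_graph_def sym_def irrefl_def)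

lemma star_graph_complete_bipartite:
  "complete_bipartite_digraph 1 n (with_proj (star_graph n))"
  unfolding complete_bipartite_digraph_pair_def
  by (intro conjI exI[of _ "{0}"] exI[of _ "{1..n}"]) (auto simp: star_graph_def)

lemma pair_graph_star_graph: "pair_graph (star_graph n)"
  using star_graph_complete_bipartite pair_graphI_complete_bipartite by blast

lemma pair_graph_cycle_graph:
  assumes "m \<ge> 2"
  shows "pair_graph (cycle_graph m)"
proof -
  have "Suc i mod m \<noteq> i" if "i < m" for i
    using that assms by (cases "Suc i = m") auto
  then have "(i, i) \<notin> parcs (cycle_graph m)" for i
    unfolding cycle_graph_def by simp metis
  then have "irrefl (parcs (cycle_graph m))"
    by (simp add: irrefl_def)
  then show ?thesis
    unfolding pair_graph_iff using assms by (auto simp: cycle_graph_def sym_def)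
qed

lemma pair_graph_wheel_graph:
  assumes "m \<ge> 2"
  shows "pair_graph (wheel_graph m)"
proof -
  have "m \<notin> pverts (cycle_graph m)"
    by (simp add: cycle_graph_def)
  then show ?thesis
    using pair_graph_cycle_graph[OF assms] unfolding pair_graph_iff
    by (auto simp: wheel_graph_def sym_def irrefl_def)
qed

lemma contains_copy_iff:
  assumes "pair_graph G" "pair_graph F"
  shows "contains_copy G F \<longleftrightarrow>
    (\<exists>f. inj_on f (pverts F) \<and> f ` pverts F \<subseteq> pverts G \<and>
         (\<forall>(u, v) \<in> parcs F. (f u, f v) \<in> parcs G))"
proof
  assume "contains_copy G F"
  then obtain H f where sub: "subgraph (with_proj H) (with_proj G)"
    and iso: "pre_digraph.digraph_isomorphism (with_proj F) f"
    and H: "with_proj H = app_iso f (with_proj F)"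
    unfolding contains_copy_def digraph_iso_def by blast
  have verts: "pverts H = iso_verts f ` pverts F" and arcs: "parcs H = iso_arcs f ` parcs F"
    and ends: "iso_tail f = fst" "iso_head f = snd"
    using H by (simp_all add: with_proj_def app_iso_def)
  have arc: "(iso_verts f u, iso_verts f v) = iso_arcs f (u, v)" if "(u, v) \<in> parcs F" for u v
    using iso that unfolding pre_digraph.digraph_isomorphism_def ends by (auto simp: prod_eq_iff)
  have inj: "inj_on (iso_verts f) (pverts F)"
    using iso unfolding pre_digraph.digraph_isomorphism_def by simp
  have subs: "pverts H \<subseteq> pverts G" "parcs H \<subseteq> parcs G"
    using sub by (auto simp: subgraph_def)
  show "\<exists>f. inj_on f (pverts F) \<and> f ` pverts F \<subseteq> pverts G \<and>
         (\<forall>(u, v) \<in> parcs F. (f u, f v) \<in> parcs G)"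
    using inj subs arc verts arcs by (intro exI[of _ "iso_verts f"]) auto
next
  assume "\<exists>f. inj_on f (pverts F) \<and> f ` pverts F \<subseteq> pverts G \<and>
         (\<forall>(u, v) \<in> parcs F. (f u, f v) \<in> parcs G)"
  then obtain f where f: "inj_on f (pverts F)" "f ` pverts F \<subseteq> pverts G"
    "\<forall>(u, v) \<in> parcs F. (f u, f v) \<in> parcs G"
    by (elim exE conjE)
  interpret F: pair_graph F by fact
  interpret G: pair_graph G by fact
  define H where "H = \<lparr> pverts = f ` pverts F, parcs = map_prod f f ` parcs F \<rparr>"
  have F: "finite (pverts F)" "parcs F \<subseteq> pverts F \<times> pverts F" "sym (parcs F)"
    using assms(2) by (auto simp: pair_graph_iff)
  have subs: "pverts H \<subseteq> pverts G" "parcs H \<subseteq> parcs G"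
    using f by (auto simp: H_def)
  have "irrefl (parcs H)"
    using subs assms(1) by (auto simp: pair_graph_iff irrefl_def)
  moreover have "sym (parcs H)"
    using F(3) by (fastforce simp: H_def sym_def)
  ultimately have H: "pair_graph H"
    unfolding pair_graph_iff using F(1,2) by (auto simp: H_def)
  then interpret H: pair_graph H .
  have "subgraph (with_proj H) (with_proj G)"
    using subs H.wf_digraph G.wf_digraph by (simp add: subgraph_def compatible_def)
  moreover have "digraph_iso (with_proj F) (with_proj H)"
    unfolding digraph_iso_def
  proof (intro exI conjI)
    let ?h = "\<lparr> iso_verts = f, iso_arcs = map_prod f f, iso_head = snd, iso_tail = fst \<rparr>"
    have "inj_on (map_prod f f) (parcs F)"
      using map_prod_inj_on[OF f(1) f(1)] F(2) inj_on_subset by blast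
    then show "pre_digraph.digraph_isomorphism (with_proj F) ?h"
      using f(1) F.wf_digraph by (simp add: pre_digraph.digraph_isomorphism_def)
    show "with_proj H = app_iso ?h (with_proj F)"
      by (simp add: with_proj_def app_iso_def H_def)
  qed
  ultimately show "contains_copy G F"
    using H unfolding contains_copy_def by blast
qed

lemma contains_copy_clique:
  assumes G: "pair_graph G" and F: "pair_graph F"
    and R: "R \<subseteq> pverts G" "card R = card (pverts F)"
    and adj: "\<And>u v. u \<in> R \<Longrightarrow> v \<in> R \<Longrightarrow> u \<noteq> v \<Longrightarrow> (u, v) \<in> parcs G"
  shows "contains_copy G F"
proof -
  have fin: "finite R" "finite (pverts F)"
    using G F R(1) finite_subset by (auto simp: pair_graph_iff)
  then obtain f where f: "bij_betw f (pverts F) R"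
    using R(2) by (metis finite_same_card_bij)
  have "(f u, f v) \<in> parcs G" if "(u, v) \<in> parcs F" for u v
  proof -
    have uv: "u \<in> pverts F" "v \<in> pverts F" "u \<noteq> v"
      using F that by (auto simp: pair_graph_iff irrefl_def)
    then have "f u \<noteq> f v"
      using f by (auto simp: bij_betw_def inj_on_def)
    then show ?thesis
      using uv adj f by (auto simp: bij_betw_def)
  qed
  then show ?thesis
    using f R(1) unfolding contains_copy_iff[OF G F] by (intro exI[of _ f]) (auto simp: bij_betw_def)
qed

lemma ramsey_property_ex:
  assumes "pair_graph G1" "pair_graph G2"
  shows "\<exists>r. ramsey_property G1 G2 r"
proof -
  obtain r where r: "\<And>(V :: nat set) E. finite V \<Longrightarrow> card V \<ge> r \<Longrightarrow>
    \<exists>R\<subseteq>V. card R = card (pverts G1) \<and> clique R E \<or> card R = card (pverts G2) \<and> indep R E"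
    using ramsey2[where 'a = nat] by metis
  have "contains_copy G G1 \<or> contains_copy (complement_graph G) G2"
    if G: "pair_graph G" "card (pverts G) = r" for G :: "nat pair_pre_digraph"
  proof -
    define E where "E = (\<lambda>(u, v). {u, v}) ` parcs G"
    have sym: "sym (parcs G)"
      using G by (simp add: pair_graph_iff)
    have E: "{u, v} \<in> E \<longleftrightarrow> (u, v) \<in> parcs G" for u v
      using sym by (auto simp: E_def doubleton_eq_iff image_iff sym_def Bex_def)
    obtain R where R: "R \<subseteq> pverts G"
      "card R = card (pverts G1) \<and> clique R E \<or> card R = card (pverts G2) \<and> indep R E"
      using r[of "pverts G" E] G by (auto simp: pair_graph_iff)
    from R(2) show ?thesis
    proof
      assume "card R = card (pverts G1) \<and> clique R E"
      then have "contains_copy G G1"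
        using R(1) G(1) assms(1) by (intro contains_copy_clique) (auto simp: clique_def E)
      then show ?thesis ..
    next
      assume "card R = card (pverts G2) \<and> indep R E"
      then have "contains_copy (complement_graph G) G2"
        using R(1) pair_graph_complement_graph[OF G(1)] assms(2)
        by (intro contains_copy_clique[where R = R]) (auto simp: indep_def E complement_graph_def)
      then show ?thesis ..
    qed
  qed
  then show ?thesis
    unfolding ramsey_property_def by blast
qed

lemma ramsey_number_attained:
  assumes "pair_graph G1" "pair_graph G2"
  shows "ramsey_property G1 G2 (ramsey_number G1 G2)"
  unfolding ramsey_number_def using ramsey_property_ex[OF assms] by (rule LeastI_ex)

end

theory Submission
  imports Defs
begin

text \<open>
  Let \<open>k = m / 2\<close>, and let \<open>d = k - 2\<close> if \<open>n\<close> and \<open>k\<close> are both even and \<open>d = k - 1\<close> otherwise, so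
  that \<open>d * (n + d)\<close> is even. We describe the complement \<open>H\<close> of a graph on \<open>2 * n + d\<close> vertices with
  maximum degree \<open>n - 1\<close>. Join an independent set \<open>B\<close> of size \<open>n\<close> completely to a \<open>d\<close>-regular graph
  on a set \<open>A\<close> of size \<open>n + d\<close> whose components have at most \<open>2 * d + 1 < m\<close> vertices. Every vertex of
  \<open>H\<close> has degree \<open>n + d\<close>. A wheel in \<open>H\<close> with hub in \<open>B\<close> would have its rim inside one component of
  \<open>A\<close>, which is too small. A wheel with hub in \<open>A\<close> would have at most \<open>d < k\<close> rim vertices in \<open>A\<close>,
  hence two consecutive ones in the independent set \<open>B\<close>.
\<close>

section \<open>Regular graphs with small components\<close>

text \<open>The set counted is the neighbourhood of \<open>u\<close> in the circulant graph with
  connection set \<open>S\<close>; subtracting \<open>u\<close> modulo \<open>s\<close> maps it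
  bijectively onto \<open>S\<close>.\<close>

lemma card_circulant_neighbours:
  fixes s :: nat and S :: "int set"
  assumes "S \<subseteq> {0..<int s}" "u < s"
  shows "card {v. v < s \<and> (int v - int u) mod int s \<in> S} = card S"
proof (rule bij_betw_same_card)
  show "bij_betw (\<lambda>v. (int v - int u) mod int s) {v. v < s \<and> (int v - int u) mod int s \<in> S} S"
  proof (rule bij_betw_byWitness[where f' = "\<lambda>t. nat ((int u + t) mod int s)"])
    show "\<forall>v\<in>{v. v < s \<and> (int v - int u) mod int s \<in> S}.
        nat ((int u + (int v - int u) mod int s) mod int s) = v"
      by (auto simp: mod_add_right_eq)
    show "\<forall>t\<in>S. (int (nat ((int u + t) mod int s)) - int u) mod int s = t"
    proof
      fix t assume "t \<in> S"
      then have t: "0 \<le> t" "t < int s"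
        using assms(1) by auto
      have "(int (nat ((int u + t) mod int s)) - int u) mod int s = ((int u + t) mod int s - int u) mod int s"
        using assms(2) by simp
      also have "\<dots> = t mod int s"
        by (simp add: mod_diff_left_eq)
      finally show "(int (nat ((int u + t) mod int s)) - int u) mod int s = t"
        using t by simp
    qed
    then show "(\<lambda>t. nat ((int u + t) mod int s)) ` S \<subseteq> {v. v < s \<and> (int v - int u) mod int s \<in> S}"
      using assms(2) by (auto simp: nat_less_iff)
  qed auto
qed

text \<open>\<open>S\<close> serves as connection set of a circulant graph: omitting 0 rules out
  loops, and closure under negation makes adjacency symmetric.\<close>

lemma symmetric_residue_set_exists:
  fixes d s :: nat
  assumes "d < s" "even (d * s)"
  shows "\<exists>S \<subseteq> {1..<int s}. card S = d \<and> (\<forall>t\<in>S. int s - t \<in> S)"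
proof -
  define j where "j = d div 2"
  \<comment> \<open>The residues 1, ..., \<open>j\<close> and their negatives, one element short of
    \<open>d\<close> when \<open>d\<close> is odd.\<close>
  define T where "T = {1..int j} \<union> {int s - int j..<int s}"
  have j: "2 * j \<le> d" "2 * j < s"
    using assms by (auto simp: j_def)
  have "card T = j + j"
    unfolding T_def using j by (subst card_Un_disjoint) auto
  then have T: "T \<subseteq> {1..<int s}" "card T = 2 * j" "\<forall>t\<in>T. int s - t \<in> T"
    using j by (auto simp: T_def)
  show ?thesis
  proof (cases "even d")
    case True
    then show ?thesis
      using T by (intro exI[of _ T]) (auto simp: j_def)
  next
    case False
    \<comment> \<open>For odd \<open>d\<close>, \<open>s\<close> must be even, and the self-inverse
      residue \<open>s / 2\<close> supplies the missing element.\<close>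
    then obtain h where h: "s = 2 * h"
      using assms(2) by auto
    have d: "d = Suc (2 * j)"
      using False by (simp add: j_def)
    then have "int h \<notin> T" "finite T"
      using assms(1) h by (auto simp: T_def)
    then show ?thesis
      using T h d assms(1) by (intro exI[of _ "insert (int h) T"]) auto
  qed
qed

lemma regular_graph_exists:
  fixes d s :: nat
  assumes "d < s" "even (d * s)"
  shows "\<exists>R. (\<forall>u v. R u v \<longrightarrow> u < s \<and> v < s \<and> u \<noteq> v \<and> R v u) \<and> (\<forall>u<s. card {v. R u v} = d)"
proof -
  obtain S where S: "S \<subseteq> {1..<int s}" "card S = d" "\<And>t. t \<in> S \<Longrightarrow> int s - t \<in> S"
    using symmetric_residue_set_exists[OF assms] by auto
  define R where "R = (\<lambda>u v. u < s \<and> v < s \<and> (int v - int u) mod int s \<in> S)"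
  have "R v u \<and> u \<noteq> v" if "R u v" for u v
  proof -
    have *: "(int v - int u) mod int s \<in> S" "u < s" "v < s"
      using that by (auto simp: R_def)
    then have "(int v - int u) mod int s \<noteq> 0"
      using S(1) by auto
    moreover have "int u - int v = - (int v - int u)"
      by simp
    ultimately have "(int u - int v) mod int s = int s - (int v - int u) mod int s"
      by (simp only: zmod_zminus1_eq_if if_False)
    then show ?thesis
      using * S(1,3) by (auto simp: R_def)
  qed
  moreover have "card {v. R u v} = d" if "u < s" for u
    using card_circulant_neighbours[of S s u] S(1,2) that by (force simp: R_def)
  ultimately show ?thesis
    by (intro exI[of _ R]) (auto simp: R_def)
qed

text \<open>The function \<open>c\<close> labels unions of components. Cliques on \<open>d + 1\<close> vertices are split off until at
  most \<open>2 * d + 1\<close> vertices are left; this preserves the parity condition.\<close>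

lemma regular_graph_small_components_exists:
  fixes d s :: nat
  assumes "d < s" "even (d * s)"
  shows "\<exists>R (c :: nat \<Rightarrow> nat).
    (\<forall>u v. R u v \<longrightarrow> u < s \<and> v < s \<and> u \<noteq> v \<and> R v u \<and> c u = c v) \<and>
    (\<forall>u<s. card {v. R u v} = d) \<and> (\<forall>i. card {u. u < s \<and> c u = i} \<le> 2 * d + 1)"
  using assms
proof (induction s rule: less_induct)
  case (less s)
  show ?case
  proof (cases "s \<le> 2 * d + 1")
    case True
    obtain R where R: "\<And>u v. R u v \<Longrightarrow> u < s \<and> v < s \<and> u \<noteq> v \<and> R v u"
      "\<And>u. u < s \<Longrightarrow> card {v. R u v} = d"
      using regular_graph_exists[OF less.prems] by blast
    have "card {u. u < s \<and> (\<lambda>_. 0) u = i} \<le> 2 * d + 1" for i :: nat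
      using True by (cases "i = 0") auto
    then show ?thesis
      using R by (intro exI[of _ R] exI[of _ "\<lambda>_. 0"]) blast
  next
    case False
    define t where "t = s - (d + 1)"
    have s: "s = t + (d + 1)"
      using False by (simp add: t_def)
    have "d < t" "t < s"
      using False s by auto
    \<comment> \<open>\<open>d * s\<close> and \<open>d * t\<close> differ by the even number
      \<open>d * (d + 1)\<close>.\<close>
    moreover have "even (d * t)"
      using less.prems(2) by (auto simp: s)
    ultimately obtain R c where R: "\<And>u v. R u v \<Longrightarrow> u < t \<and> v < t \<and> u \<noteq> v \<and> R v u \<and> c u = c v"
      "\<And>u. u < t \<Longrightarrow> card {v. R u v} = d" "\<And>i :: nat. card {u. u < t \<and> c u = i} \<le> 2 * d + 1"
      using less.IH[of t] by blast
    define R' where "R' = (\<lambda>u v. R u v \<or> t \<le> u \<and> u < s \<and> t \<le> v \<and> v < s \<and> u \<noteq> v)"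
    \<comment> \<open>Old labels are shifted so that 0 is free for the new clique.\<close>
    define c' where "c' = (\<lambda>u. if u < t then Suc (c u) else 0)"
    have "u < s \<and> v < s \<and> u \<noteq> v \<and> R' v u \<and> c' u = c' v" if "R' u v" for u v
      using that R(1)[of u v] \<open>t < s\<close> by (auto simp: R'_def c'_def)
    moreover have "card {v. R' u v} = d" if "u < s" for u
    proof (cases "u < t")
      case True
      then show ?thesis
        using R(2) by (simp add: R'_def)
    next
      case False
      then have "{v. R' u v} = {t..<s} - {u}"
        using R(1) that by (auto simp: R'_def)
      then show ?thesis
        using False that by (simp add: s)
    qed
    moreover have "card {u. u < s \<and> c' u = i} \<le> 2 * d + 1" for i
    proof (cases i)
      case 0
      then have "{u. u < s \<and> c' u = i} = {t..<s}"
        by (auto simp: c'_def)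
      then show ?thesis
        by (simp add: s)
    next
      case (Suc l)
      then have "{u. u < s \<and> c' u = i} = {u. u < t \<and> c u = l}"
        using \<open>t < s\<close> by (auto simp: c'_def)
      then show ?thesis
        using R(3) by simp
    qed
    ultimately show ?thesis
      by (intro exI[of _ R'] exI[of _ c']) blast
  qed
qed

section \<open>Stars and wheels as subgraphs\<close>

lemma not_contains_star:
  assumes G: "pair_graph G"
    and deg: "\<And>u. u \<in> pverts G \<Longrightarrow> card {v. (u, v) \<in> parcs G} < n"
  shows "\<not> contains_copy G (star_graph n)"
proof
  assume "contains_copy G (star_graph n)"
  then obtain f where "inj_on f (pverts (star_graph n))" "f ` pverts (star_graph n) \<subseteq> pverts G"
    and "\<forall>(u, v) \<in> parcs (star_graph n). (f u, f v) \<in> parcs G"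
    unfolding contains_copy_iff[OF G pair_graph_star_graph] by blast
  moreover have "pverts (star_graph n) = {0..n}"
    by (simp add: star_graph_def)
  ultimately have f: "inj_on f {0..n}" "f ` {0..n} \<subseteq> pverts G"
    "\<And>u v. (u, v) \<in> parcs (star_graph n) \<Longrightarrow> (f u, f v) \<in> parcs G"
    by auto
  have "f ` {1..n} \<subseteq> {v. (f 0, v) \<in> parcs G}"
    using f(3)[of 0] by (auto simp: star_graph_def)
  moreover have "finite {v. (f 0, v) \<in> parcs G}"
    by (rule finite_subset[of _ "pverts G"]) (use G in \<open>auto simp: pair_graph_iff\<close>)
  ultimately have "card (f ` {1..n}) \<le> card {v. (f 0, v) \<in> parcs G}"
    by (rule card_mono[rotated])
  moreover have "card (f ` {1..n}) = n"
    using f(1) by (subst card_image) (auto intro: inj_on_subset)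
  moreover have "f 0 \<in> pverts G"
    using f(2) by auto
  ultimately show False
    using deg[of "f 0"] by simp
qed

lemma contains_wheelE:
  assumes G: "pair_graph G" and m: "2 \<le> m" and "contains_copy G (wheel_graph m)"
  obtains h g where "inj_on g {..<m}"
    "\<And>i. i < m \<Longrightarrow> (h, g i) \<in> parcs G" "\<And>i. i < m \<Longrightarrow> (g i, g (Suc i mod m)) \<in> parcs G"
proof -
  obtain f where "inj_on f (pverts (wheel_graph m))" "f ` pverts (wheel_graph m) \<subseteq> pverts G"
    and arcs: "\<forall>(u, v) \<in> parcs (wheel_graph m). (f u, f v) \<in> parcs G"
    using assms(3) unfolding contains_copy_iff[OF G pair_graph_wheel_graph[OF m]] by blast
  moreover have "pverts (wheel_graph m) = {..m}"
    by (auto simp: wheel_graph_def cycle_graph_def)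
  ultimately have f: "inj_on f {..m}" "f ` {..m} \<subseteq> pverts G"
    "\<And>u v. (u, v) \<in> parcs (wheel_graph m) \<Longrightarrow> (f u, f v) \<in> parcs G"
    by auto
  show ?thesis
  proof (rule that)
    show "inj_on f {..<m}"
      using f(1) by (rule inj_on_subset) auto
    show "(f m, f i) \<in> parcs G" if "i < m" for i
      using that by (intro f(3)) (auto simp: wheel_graph_def cycle_graph_def)
    show "(f i, f (Suc i mod m)) \<in> parcs G" if "i < m" for i
      using that by (intro f(3)) (auto simp: wheel_graph_def cycle_graph_def)
  qed
qed

lemma inj_on_Suc_mod: "inj_on (\<lambda>i. Suc i mod m) {..<m}"
  by (rule inj_onI) (auto simp: mod_Suc split: if_splits)

text \<open>The successor map on the cycle sends the complement of \<open>J\<close> injectively into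
  \<open>J\<close>.\<close>

lemma card_le_twice_vertex_cover_of_cycle:
  assumes "J \<subseteq> {..<m}" and "\<And>i. i < m \<Longrightarrow> i \<in> J \<or> Suc i mod m \<in> J"
  shows "m \<le> 2 * card J"
proof -
  have "finite J"
    using assms(1) finite_subset by blast
  have "(\<lambda>i. Suc i mod m) ` ({..<m} - J) \<subseteq> J"
    using assms(2) by auto
  then have "card ({..<m} - J) \<le> card J"
    using \<open>finite J\<close> inj_on_subset[OF inj_on_Suc_mod] by (intro card_inj_on_le) auto
  then show ?thesis
    using assms(1) \<open>finite J\<close> by (simp add: card_Diff_subset)
qed

section \<open>The lower bound\<close>

lemma ramsey_number_star_wheel_gt:
  fixes n m d :: nat
  assumes "even (d * (n + d))" "0 < n" "2 * d + 1 < m"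
  shows "2 * n + d < ramsey_number (star_graph n) (wheel_graph m)"
proof -
  have m: "2 \<le> m"
    using assms(3) by simp
  obtain R c where R: "\<And>u v. R u v \<Longrightarrow> u < n + d \<and> v < n + d \<and> u \<noteq> v \<and> R v u \<and> c u = c v"
    "\<And>u. u < n + d \<Longrightarrow> card {v. R u v} = d"
    "\<And>i :: nat. card {u. u < n + d \<and> c u = i} \<le> 2 * d + 1"
    using regular_graph_small_components_exists[of d "n + d"] assms by auto
  \<comment> \<open>Adjacency in \<open>H\<close>: \<open>A\<close> consists of the numbers below
    \<open>n + d\<close>, \<open>B\<close> of the others.\<close>
  define P where "P = (\<lambda>u v. (u < n + d) \<noteq> (v < n + d) \<or> R u v)"
  \<comment> \<open>All smaller \<open>r\<close> are excluded too, by keeping only the first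
    \<open>r\<close> vertices, since the Ramsey number is known only to have the property.\<close>
  have "\<not> ramsey_property (star_graph n) (wheel_graph m) r" if r: "r \<le> 2 * n + d" for r
  proof -
    define G :: "nat pair_pre_digraph" where
      "G = \<lparr> pverts = {..<r}, parcs = {(u, v). u < r \<and> v < r \<and> u \<noteq> v \<and> \<not> P u v} \<rparr>"
    define H where "H = complement_graph G"
    have G: "pair_graph G"
      using R(1) by (auto simp: pair_graph_iff G_def sym_def irrefl_def P_def)
    then have H: "pair_graph H"
      unfolding H_def by (rule pair_graph_complement_graph)
    have parcs_H: "parcs H \<subseteq> {(u, v). u < r \<and> v < r \<and> P u v}"
      by (auto simp: H_def G_def complement_graph_def)
    have "card {v. (u, v) \<in> parcs G} < n" if "u \<in> pverts G" for u
    proof (cases "u < n + d")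
      case True
      have fin: "finite {v. R u v}"
        by (rule finite_subset[of _ "{..<n + d}"]) (use R(1) in auto)
      \<comment> \<open>In \<open>G\<close>, \<open>u\<close> misses \<open>B\<close>, itself and
        its \<open>d\<close> neighbours under \<open>R\<close>.\<close>
      have "card {v. (u, v) \<in> parcs G} \<le> card ({..<n + d} - insert u {v. R u v})"
        using True by (intro card_mono) (auto simp: G_def P_def)
      also have "\<dots> = n + d - Suc d"
        using R(1,2) True fin by (subst card_Diff_subset) (auto simp: card_insert_if)
      finally show ?thesis
        using assms(2) by simp
    next
      case False
      then have u: "u \<in> {n + d..<2 * n + d}"
        using that r by (auto simp: G_def)
      have "card {v. (u, v) \<in> parcs G} \<le> card ({n + d..<2 * n + d} - {u})"
        using False r by (intro card_mono) (auto simp: G_def P_def)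
      also have "\<dots> = n - 1"
        using u by simp
      finally show ?thesis
        using assms(2) by linarith
    qed
    then have "\<not> contains_copy G (star_graph n)"
      using not_contains_star[OF G] by blast
    moreover have "\<not> contains_copy H (wheel_graph m)"
    proof
      assume "contains_copy H (wheel_graph m)"
      then obtain h g where g: "inj_on g {..<m}"
        and "\<And>i. i < m \<Longrightarrow> (h, g i) \<in> parcs H"
        and "\<And>i. i < m \<Longrightarrow> (g i, g (Suc i mod m)) \<in> parcs H"
        by (rule contains_wheelE[OF H m]) (rule that)
      then have spoke: "P h (g i)" and rim: "P (g i) (g (Suc i mod m))" if "i < m" for i
        using parcs_H that by auto
      show False
      proof (cases "h < n + d")
        case True
        \<comment> \<open>These positions cover every rim edge because \<open>B\<close> is
          independent, but the hub has only \<open>d\<close> neighbours in \<open>A\<close>.\<close>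
        define J where "J = {i. i < m \<and> g i < n + d}"
        have fin: "finite {v. R h v}"
          by (rule finite_subset[of _ "{..<n + d}"]) (use R(1) in auto)
        have "i \<in> J \<or> Suc i mod m \<in> J" if "i < m" for i
          using rim[OF that] that R(1) by (auto simp: J_def P_def)
        then have "m \<le> 2 * card J"
          by (intro card_le_twice_vertex_cover_of_cycle) (auto simp: J_def)
        also have "card J \<le> card {v. R h v}"
        proof (rule card_inj_on_le)
          show "inj_on g J"
            using g by (rule inj_on_subset) (auto simp: J_def)
          show "g ` J \<subseteq> {v. R h v}"
            using spoke True by (auto simp: J_def P_def)
        qed (fact fin)
        finally show False
          using R(2)[OF True] assms(3) by simp
      next
        case False
        have A: "g i < n + d" if "i < m" for i
          using spoke[OF that] False R(1) by (auto simp: P_def)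
        \<comment> \<open>The rim without its closing edge already forces a single label.\<close>
        have "c (g (Suc i)) = c (g i)" if "Suc i < m" for i
          using rim[of i] A[of i] A[of "Suc i"] R(1) that by (auto simp: P_def)
        then have "c (g i) = c (g 0)" if "i < m" for i
          using that by (induction i) auto
        then have "g ` {..<m} \<subseteq> {u. u < n + d \<and> c u = c (g 0)}"
          using A by auto
        then have "card {..<m} \<le> card {u. u < n + d \<and> c u = c (g 0)}"
          using g by (intro card_inj_on_le) auto
        then show False
          using R(3)[of "c (g 0)"] assms(3) by simp
      qed
    qed
    ultimately show ?thesis
      using G unfolding ramsey_property_def H_def by (auto simp: G_def intro!: exI[of _ G])
  qed
  moreover have "ramsey_property (star_graph n) (wheel_graph m)
      (ramsey_number (star_graph n) (wheel_graph m))"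
    using m by (intro ramsey_number_attained pair_graph_star_graph pair_graph_wheel_graph)
  ultimately show ?thesis
    using not_le_imp_less by blast
qed

theorem theorem3:
  fixes n m :: nat
  assumes "even m" and "6 \<le> m" and "m \<le> 2 * n - 2"
  shows "ramsey_number (star_graph n) (wheel_graph m) \<ge>
    (if even n \<and> even (m div 2) then 2 * n + m div 2 - 1 else 2 * n + m div 2)"
proof -
  define k where "k = m div 2"
  have k: "m = 2 * k" "3 \<le> k" "0 < n"
    using assms by (auto simp: k_def)
  show ?thesis
  proof (cases "even n \<and> even k")
    case True
    \<comment> \<open>Here \<open>d = k - 2\<close> is even.\<close>
    then have "2 * n + (k - 2) < ramsey_number (star_graph n) (wheel_graph m)"
      using k by (intro ramsey_number_star_wheel_gt) auto
    then show ?thesis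
      using True k by simp
  next
    case False
    \<comment> \<open>Either \<open>k\<close> is odd and \<open>d = k - 1\<close> is even, or
      \<open>k\<close> is even, \<open>n\<close> is odd and \<open>n + d\<close> is even. The size
      bound is tight: \<open>2 * d + 1 = m - 1\<close>.\<close>
    then have "2 * n + (k - 1) < ramsey_number (star_graph n) (wheel_graph m)"
      using k by (intro ramsey_number_star_wheel_gt) auto
    then show ?thesis
      using False k by auto
  qed
qed

end
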